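(* Let $V$ be an $n\times m$ F-matrix and let $\mathbf{w}\in\mathbb{R}^m$ be generic for $I_V$. Then $\mathrm{in}_{\mathbf{w}}(I_V)$ is an initial ideal of $I_V$ (that is, $\mathrm{in}_{\mathbf{w}}(I_V)=\mathrm{in}_{\preceq}(I_V)$ for some term order $\preceq$) if and only if $\mathbf{w}\in\mathcal{W}$.
   Context: An F-matrix is an $n\times m$ integer matrix $V=(\mathbf{v}_1,\ldots,\mathbf{v}_m)$ such that: $V$ has rank $n$; all columns are nonzero; no column is a positive real multiple of another column; the cone generated by the columns is $\mathbb{R}^n$; and the gcd of the entries of every column is $1$. $\mathbb{K}$ is a field of characteristic $0$. The toric ideal $I_V\subseteq\mathbb{K}[x_1,\ldots,x_m]$ is the kernel of the ring homomorphism $\mathbb{K}[x_1,\ldots,x_m]\to\mathbb{K}[t_1^{\pm1},\ldots,t_n^{\pm1}]$, $x_j\mapsto \mathbf{t}^{\mathbf{v}_j}$. For $\mathbf{w}\in\mathbb{R}^m$ and $f=\sum_{\mathbf{a}}c_{\mathbf{a}}\mathbf{x}^{\mathbf{a}}$, $\mathrm{in}_{\mathbf{w}}(f)$ is the sum of all terms $c_{\mathbf{a}}\mathbf{x}^{\mathbf{a}}$ of $f$ (with $c_{\mathbf a}\neq 0$) for which $\mathbf{w}^T\mathbf{a}$ is maximal; for an ideal $I$, $\mathrm{in}_{\mathbf{w}}(I)$ is the ideal generated by $\{\mathrm{in}_{\mathbf{w}}(f) : f\in I\}$. The vector $\mathbf{w}$ is generic for $I$ if $\mathrm{in}_{\mathbf{w}}(I)$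 is a monomial ideal. A monomial ideal $J$ is called an initial ideal of $I$ if $J=\mathrm{in}_{\preceq}(I)$ (the usual ideal of leading monomials) for some term order $\preceq$ on $\mathbb{N}^m$ (a total order compatible with addition having $\mathbf{0}$ as minimum). Let $\mathcal{U}=\{\mathbf{u}\in\mathbb{R}^m : V\mathbf{u}=\mathbf{0},\ \mathbf{u}\ge\mathbf{0}\}$ and $\mathcal{W}=\{\mathbf{w}\in\mathbb{R}^m : \mathbf{u}\mapsto\mathbf{w}^T\mathbf{u}\text{ is bounded below on }\mathcal{U}\}$. *)

theory Defs
  imports "HOL-Analysis.Analysis" "HOL-Library.Poly_Mapping"
begin

text \<open>
  An integer matrix with \<open>n = CARD('n)\<close> rows and \<open>m = CARD('m)\<close> columns has type
  \<^typ>\<open>int^'m^'n\<close>.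
\<close>

abbreviation real_matrix :: "int^'m^'n \<Rightarrow> real^'m^'n" where
  "real_matrix V \<equiv> map_matrix real_of_int V"

definition F_matrix :: "int^'m^'n \<Rightarrow> bool" where
  "F_matrix V \<longleftrightarrow>
     rank (real_matrix V) = CARD('n) \<and>
     (\<forall>j. column j V \<noteq> 0) \<and>
     (\<forall>j k. j \<noteq> k \<longrightarrow>
        \<not> (\<exists>c::real. c > 0 \<and> column j (real_matrix V) = c *\<^sub>R column k (real_matrix V))) \<and>
     convex_cone hull (columns (real_matrix V)) = UNIV \<and>
     (\<forall>j. Gcd (range (\<lambda>i. V $ i $ j)) = 1)"

text \<open>
  Polynomials in variables indexed by \<open>'m\<close> and Laurent polynomials in variables indexed by
  \<open>'n\<close> are the monoid algebras of \<^typ>\<open>nat^'m\<close> and \<^typ>\<open>int^'n\<close>; their product is the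
  convolution product of \<^theory>\<open>HOL-Library.Poly_Mapping\<close>. In both rings
  \<^term>\<open>Poly_Mapping.single a c\<close> is the term with coefficient \<open>c\<close> and exponent vector \<open>a\<close>.
\<close>

type_synonym ('k, 'm) mpoly = "(nat^'m) \<Rightarrow>\<^sub>0 'k"
type_synonym ('k, 'n) laurent = "(int^'n) \<Rightarrow>\<^sub>0 'k"

text \<open>
  This is the unique \<open>'k\<close>-algebra homomorphism mapping the \<open>j\<close>-th variable to the Laurent monomial
  with exponent \<^term>\<open>column j V\<close>: see \<open>toric_map_variable\<close>, \<open>toric_map_constant\<close>,
  \<open>toric_map_add\<close> and \<open>toric_map_mult\<close>.
\<close>

definition toric_map :: "int^'m^'n \<Rightarrow> ('k::field_char_0, 'm::finite) mpoly \<Rightarrow> ('k, 'n) laurent" where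
  "toric_map V f =
     (\<Sum>a\<in>Poly_Mapping.keys f.
        Poly_Mapping.single 0 (Poly_Mapping.lookup f a) *
        (\<Prod>j\<in>UNIV. Poly_Mapping.single (column j V) 1 ^ (a $ j)))"

lemma single_power:
  "Poly_Mapping.single (v::int^'n) (1::'k::field_char_0) ^ k = Poly_Mapping.single (of_nat k * v) 1"
  by (induction k) (simp_all add: mult_single algebra_simps flip: single_one)

lemma prod_single:
  "finite A \<Longrightarrow> (\<Prod>j\<in>A. Poly_Mapping.single (g j :: int^'n) (1::'k::field_char_0)) =
     Poly_Mapping.single (\<Sum>j\<in>A. g j) 1"
  by (induction A rule: finite_induct) (simp_all add: mult_single flip: single_one)

lemma toric_map_monomials:
  fixes f :: "('k::field_char_0, 'm::finite) mpoly"
  shows "toric_map V f =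
     (\<Sum>a\<in>Poly_Mapping.keys f.
        Poly_Mapping.single (\<Sum>j\<in>UNIV. of_nat (a $ j) * column j V) (Poly_Mapping.lookup f a))"
  unfolding toric_map_def by (simp add: single_power prod_single mult_single)

lemma toric_map_superset:
  fixes f :: "('k::field_char_0, 'm::finite) mpoly"
  assumes "finite A" "Poly_Mapping.keys f \<subseteq> A"
  shows "toric_map V f =
     (\<Sum>a\<in>A. Poly_Mapping.single (\<Sum>j\<in>UNIV. of_nat (a $ j) * column j V) (Poly_Mapping.lookup f a))"
  unfolding toric_map_monomials
  using assms by (intro sum.mono_neutral_left) (auto simp: in_keys_iff)

lemma toric_map_single:
  "toric_map V (Poly_Mapping.single a c) =
     Poly_Mapping.single (\<Sum>j\<in>UNIV. of_nat (a $ j) * column j V) (c::'k::field_char_0)"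
  by (subst toric_map_superset[of "{a}"]) auto

lemma toric_map_variable:
  "toric_map V (Poly_Mapping.single (axis j 1) (1::'k::field_char_0)) =
     Poly_Mapping.single (column j V) 1"
proof -
  have "(\<Sum>i\<in>UNIV. of_nat (axis j 1 $ i) * column i V) = 
        (\<Sum>i\<in>UNIV. if i = j then column i V else 0)"
    by (rule sum.cong) (auto simp: axis_def)
  then show ?thesis by (simp add: toric_map_single)
qed

lemma toric_map_constant:
  "toric_map V (Poly_Mapping.single 0 c) = Poly_Mapping.single 0 (c::'k::field_char_0)"
  by (simp add: toric_map_single)

lemma toric_map_add:
  fixes f g :: "('k::field_char_0, 'm::finite) mpoly"
  shows "toric_map V (f + g) = toric_map V f + toric_map V g"
proof -
  let ?A = "Poly_Mapping.keys f \<union> Poly_Mapping.keys g"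
  have *: "finite ?A" by simp
  show ?thesis
    using Poly_Mapping.keys_add[of f g]
    by (subst (1 2 3) toric_map_superset[OF *])
       (auto simp: lookup_add single_add sum.distrib)
qed

lemma toric_map_zero: "toric_map V (0 :: ('k::field_char_0, 'm::finite) mpoly) = 0"
  by (simp add: toric_map_def)

lemma toric_map_sum:
  "toric_map V (\<Sum>i\<in>A. F i :: ('k::field_char_0, 'm::finite) mpoly) = (\<Sum>i\<in>A. toric_map V (F i))"
  by (induction A rule: infinite_finite_induct) (simp_all add: toric_map_add toric_map_zero)

lemma toric_map_mult:
  fixes f g :: "('k::field_char_0, 'm::finite) mpoly"
  shows "toric_map V (f * g) = toric_map V f * toric_map V g"
proof -
  have decomp: "h = (\<Sum>a\<in>Poly_Mapping.keys h. Poly_Mapping.single a (Poly_Mapping.lookup h a))"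
    for h :: "('k, 'm) mpoly"
    by (rule poly_mapping_eqI) (auto simp: lookup_sum lookup_single when_def in_keys_iff)
  have mono: "toric_map V (Poly_Mapping.single a c * Poly_Mapping.single b d) =
      toric_map V (Poly_Mapping.single a c) * toric_map V (Poly_Mapping.single b (d::'k))"
    for a b :: "nat^'m" and c d
    by (simp add: mult_single toric_map_single sum.distrib algebra_simps)
  have "toric_map V (f * g) = toric_map V
      ((\<Sum>a\<in>Poly_Mapping.keys f. Poly_Mapping.single a (Poly_Mapping.lookup f a)) *
       (\<Sum>b\<in>Poly_Mapping.keys g. Poly_Mapping.single b (Poly_Mapping.lookup g b)))"
    by (simp only: decomp[symmetric])
  also have "\<dots> = toric_map V (\<Sum>a\<in>Poly_Mapping.keys f. Poly_Mapping.single a (Poly_Mapping.lookup f a)) *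
      toric_map V (\<Sum>b\<in>Poly_Mapping.keys g. Poly_Mapping.single b (Poly_Mapping.lookup g b))"
    by (simp add: sum_product toric_map_sum mono)
  finally show ?thesis by (simp only: decomp[symmetric])
qed

definition toric_ideal :: "int^'m^'n \<Rightarrow> ('k::field_char_0, 'm::finite) mpoly set" where
  "toric_ideal V = {f. toric_map V f = 0}"

text \<open>A commutative ring is a module over itself; its submodules are the ideals.\<close>

interpretation ideal: module "(*) :: 'a::comm_ring_1 \<Rightarrow> 'a \<Rightarrow> 'a"
  by unfold_locales (simp_all add: algebra_simps)

definition monomial_ideal :: "('k::field_char_0, 'm::finite) mpoly set \<Rightarrow> bool" where
  "monomial_ideal J \<longleftrightarrow> (\<exists>A. J = ideal.span ((\<lambda>a. Poly_Mapping.single a 1) ` A))"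

definition weight :: "real^'m \<Rightarrow> nat^'m \<Rightarrow> real" where
  "weight w a = (\<Sum>j\<in>UNIV. w $ j * real (a $ j))"

definition initial_form :: "real^'m \<Rightarrow> ('k::field_char_0, 'm::finite) mpoly \<Rightarrow> ('k, 'm) mpoly" where
  "initial_form w f =
     (\<Sum>a\<in>{a \<in> Poly_Mapping.keys f. \<forall>b\<in>Poly_Mapping.keys f. weight w b \<le> weight w a}.
        Poly_Mapping.single a (Poly_Mapping.lookup f a))"

definition weight_initial_ideal ::
    "real^'m \<Rightarrow> ('k::field_char_0, 'm::finite) mpoly set \<Rightarrow> ('k, 'm) mpoly set" where
  "weight_initial_ideal w I = ideal.span (initial_form w ` I)"

definition generic_weight :: "real^'m \<Rightarrow> ('k::field_char_0, 'm::finite) mpoly set \<Rightarrow> bool" where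
  "generic_weight w I \<longleftrightarrow> monomial_ideal (weight_initial_ideal w I)"

text \<open>\<open>(a, b) \<in> R\<close> stands for \<open>a \<preceq> b\<close>.\<close>

definition term_order :: "(nat^'m) rel \<Rightarrow> bool" where
  "term_order R \<longleftrightarrow>
     linear_order R \<and>
     (\<forall>a b c. (a, b) \<in> R \<longrightarrow> (a + c, b + c) \<in> R) \<and>
     (\<forall>a. (0, a) \<in> R)"

text \<open>The zero polynomial has no leading exponent, so it contributes no generator.\<close>

definition is_leading_exponent ::
    "(nat^'m) rel \<Rightarrow> ('k::field_char_0, 'm::finite) mpoly \<Rightarrow> nat^'m \<Rightarrow> bool" where
  "is_leading_exponent R f a \<longleftrightarrow>
     a \<in> Poly_Mapping.keys f \<and> (\<forall>b\<in>Poly_Mapping.keys f. (b, a) \<in> R)"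

definition order_initial_ideal ::
    "(nat^'m) rel \<Rightarrow> ('k::field_char_0, 'm::finite) mpoly set \<Rightarrow> ('k, 'm) mpoly set" where
  "order_initial_ideal R I =
     ideal.span {Poly_Mapping.single a 1 | a. \<exists>f\<in>I. is_leading_exponent R f a}"

definition is_initial_ideal ::
    "('k::field_char_0, 'm::finite) mpoly set \<Rightarrow> ('k, 'm) mpoly set \<Rightarrow> bool" where
  "is_initial_ideal J I \<longleftrightarrow>
     monomial_ideal J \<and> (\<exists>R. term_order R \<and> J = order_initial_ideal R I)"

definition U_cone :: "int^'m^'n \<Rightarrow> (real^'m) set" where
  "U_cone V = {u. real_matrix V *v u = 0 \<and> (\<forall>j. 0 \<le> u $ j)}"

definition W_cone :: "int^'m^'n \<Rightarrow> (real^'m) set" where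
  "W_cone V = {w. bdd_below ((\<lambda>u. w \<bullet> u) ` U_cone V)}"

end

theory Submission
  imports Defs "HOL-Library.Fun_Lexorder"
begin

text \<open>
  Write \<open>U\<close> and \<open>W\<close> for the two cones and \<open>I\<close> for the toric ideal, which is homogeneous for the
  grading that gives the monomial \<open>x^a\<close> the degree \<open>V a\<close>.

  Suppose first that \<open>w\<close> is not in \<open>W\<close>. Then some \<open>u\<close> in \<open>U\<close> has \<open>w \<bullet> u < 0\<close>, and simultaneous
  Diophantine approximation of a multiple of \<open>u\<close> yields a natural vector \<open>a\<close> with \<open>V a = 0\<close> that
  still has negative weight (\<open>nat_relation_of_negative_weight\<close>). The binomial \<open>1 - x^a\<close> lies in
  \<open>I\<close> and its initial form is \<open>1\<close>, so \<open>in_w(I)\<close> is the whole ring. For a term order, on the other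
  hand, \<open>1\<close> can only be the leading monomial of a nonzero constant, and \<open>I\<close> contains none
  (\<open>order_initial_ideal_proper\<close>). Hence \<open>in_w(I)\<close> is not an initial ideal.

  Suppose now that \<open>w\<close> is in \<open>W\<close>, that is, \<open>w \<bullet> u \<ge> 0\<close> on \<open>U\<close>. By Farkas' lemma some
  \<open>w' = w + y V\<close> is nonnegative (\<open>farkas\<close>). The shift \<open>y V\<close> changes the weight of \<open>x^a\<close> by
  \<open>y \<bullet> V a\<close>, which depends on the degree only, so \<open>w\<close> and \<open>w'\<close> compare monomials of equal degree in
  the same way. Nonnegativity of \<open>w'\<close> allows a term order to compare by \<open>w'\<close> first and break ties
  lexicographically (\<open>term_order_refining_weight\<close>). Its initial ideal is \<open>in_w(I)\<close>
  (\<open>weight_initial_ideal_eq_order_initial_ideal\<close>): in either ideal, the monomials come from leading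
  terms of homogeneous elements of \<open>I\<close>, because an element of \<open>I\<close> can be replaced by its component in
  the degree of its leading term, and there the two kinds of leading terms agree. Genericity
  ensures that every monomial of an initial form belongs to \<open>in_w(I)\<close> by itself.
\<close>

section \<open>Term orders from lexicographic comparison of nonnegative functionals\<close>

text \<open>
  Additivity makes the first differing functional insensitive to translation, which gives
  compatibility with addition; nonnegativity puts \<open>0\<close> at the bottom. Finite
  support and injectivity guarantee that two different vectors have a first difference.
\<close>

lemma term_order_lexicographic:
  fixes e :: "nat^'m \<Rightarrow> nat \<Rightarrow> real"
  assumes add: "\<And>a b k. e (a + b) k = e a k + e b k"
    and nonneg: "\<And>a k. 0 \<le> e a k"
    and fin: "\<And>a. finite {k. e a k \<noteq> 0}"
    and inj: "inj e"
  shows "term_order {(a, b). a = b \<or> less_fun (e a) (e b)}" (is "term_order ?R")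
  unfolding term_order_def order_on_defs
proof (intro conjI allI impI)
  have trichotomy: "less_fun (e a) (e b) \<or> a = b \<or> less_fun (e b) (e a)" for a b
  proof -
    have "finite {k. e a k \<noteq> e b k}"
      by (rule finite_subset[OF _ finite_UnI[OF fin[of a] fin[of b]]]) auto
    then show ?thesis
      using less_fun_trichotomy injD[OF inj] by blast
  qed
  show "refl ?R"
    by (auto simp: refl_on_def)
  show "trans ?R"
    by (auto intro!: transI intro: less_fun_trans)
  show "antisym ?R"
    by (auto intro!: antisymI dest: less_fun_asym)
  show "total ?R"
    using trichotomy by (auto simp: total_on_def)
  show "?R \<subseteq> UNIV \<times> UNIV"
    by simp
  show "(a + c, b + c) \<in> ?R" if "(a, b) \<in> ?R" for a b c
    using that by (auto simp: less_fun_def add)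
  show "(0, a) \<in> ?R" for a
  proof -
    have "e 0 k = 0" for k
      using add[of 0 0 k] by simp
    then have "\<not> less_fun (e a) (e 0)"
      using nonneg by (auto simp: less_fun_def not_less)
    then show ?thesis
      using trichotomy[of 0 a] by auto
  qed
qed

lemma weight_add: "weight w (a + b) = weight w a + weight w b"
  by (simp add: weight_def algebra_simps sum.distrib)

text \<open>
  The weight itself is the first functional of the lexicographic comparison, and the coordinates
  follow it to separate vectors of equal weight.
\<close>

lemma term_order_refining_weight:
  fixes w :: "real^'m"
  assumes "\<And>j. 0 \<le> w $ j"
  obtains R where "term_order R" "\<And>a b. weight w a < weight w b \<Longrightarrow> (a, b) \<in> R"
proof -
  obtain h where h: "bij_betw h {0..<CARD('m)} (UNIV :: 'm set)"
    using ex_bij_betw_nat_finite[of "UNIV :: 'm set"] by auto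
  define e :: "nat^'m \<Rightarrow> nat \<Rightarrow> real" where
    "e a k = (case k of 0 \<Rightarrow> weight w a | Suc i \<Rightarrow> if i < CARD('m) then real (a $ h i) else 0)" for a k
  show ?thesis
  proof (rule that)
    show "term_order {(a, b). a = b \<or> less_fun (e a) (e b)}"
    proof (rule term_order_lexicographic)
      show "e (a + b) k = e a k + e b k" for a b k
        by (simp add: e_def weight_add split: nat.split)
      show "0 \<le> e a k" for a k
        using assms by (auto simp: e_def weight_def intro!: sum_nonneg split: nat.split)
      have "{k. e a k \<noteq> 0} \<subseteq> {..CARD('m)}" for a
        by (auto simp: e_def less_eq_Suc_le split: nat.split_asm if_split_asm)
      then show "finite {k. e a k \<noteq> 0}" for a
        using finite_subset by blast
      show "inj e"
      proof (rule injI)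
        fix a b assume eq: "e a = e b"
        have "a $ j = b $ j" for j
        proof -
          obtain i where "i < CARD('m)" "h i = j"
            using bij_betw_imp_surj_on[OF h] by (metis UNIV_I atLeastLessThan_iff imageE)
          then show ?thesis
            using fun_cong[OF eq, of "Suc i"] by (simp add: e_def)
        qed
        then show "a = b"
          by (simp add: vec_eq_iff)
      qed
    qed
    show "(a, b) \<in> {(a, b). a = b \<or> less_fun (e a) (e b)}" if "weight w a < weight w b" for a b
      using that by (auto intro!: less_funI exI[of _ 0] simp: e_def)
  qed
qed

section \<open>Monomial ideals and initial forms\<close>

lemma keys_in_monomial_span:
  fixes f :: "('k::field_char_0, 'm::finite) mpoly"
  assumes "f \<in> ideal.span ((\<lambda>a. Poly_Mapping.single a 1) ` A)" "k \<in> Poly_Mapping.keys f"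
  shows "\<exists>a\<in>A. \<exists>c. k = c + a"
  using assms
proof (induction arbitrary: k rule: ideal.span_induct_alt)
  case base
  then show ?case by simp
next
  case (step q x y)
  then have "k \<in> Poly_Mapping.keys (q * x) \<or> k \<in> Poly_Mapping.keys y"
    using Poly_Mapping.keys_add[of "q * x" y] by blast
  then show ?case
    using step keys_mult[of q x] by (auto; blast)
qed

lemma monomial_ideal_monomials:
  fixes f :: "('k::field_char_0, 'm::finite) mpoly"
  assumes "monomial_ideal J" "f \<in> J" "k \<in> Poly_Mapping.keys f"
  shows "Poly_Mapping.single k 1 \<in> J"
proof -
  obtain A where J: "J = ideal.span ((\<lambda>a. Poly_Mapping.single a 1) ` A)"
    using assms(1) by (auto simp: monomial_ideal_def)
  obtain a c where "a \<in> A" "k = c + a"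
    using keys_in_monomial_span assms(2,3) unfolding J by blast
  then have "Poly_Mapping.single k 1 = Poly_Mapping.single c 1 * Poly_Mapping.single a (1::'k)"
    by (simp add: mult_single)
  also have "\<dots> \<in> J"
    unfolding J using \<open>a \<in> A\<close> by (intro ideal.span_scale ideal.span_base) auto
  finally show ?thesis .
qed

lemma lookup_sum_single_filter:
  fixes f :: "'a \<Rightarrow>\<^sub>0 'b::comm_monoid_add"
  shows "Poly_Mapping.lookup
     (\<Sum>a\<in>{a \<in> Poly_Mapping.keys f. P a}. Poly_Mapping.single a (Poly_Mapping.lookup f a)) b =
     (if P b then Poly_Mapping.lookup f b else 0)"
proof -
  have "Poly_Mapping.lookup
     (\<Sum>a\<in>{a \<in> Poly_Mapping.keys f. P a}. Poly_Mapping.single a (Poly_Mapping.lookup f a)) b =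
     (\<Sum>a\<in>{a \<in> Poly_Mapping.keys f. P a}. if a = b then Poly_Mapping.lookup f a else 0)"
    by (auto simp: lookup_sum lookup_single when_def intro!: sum.cong)
  then show ?thesis
    by (auto simp: sum.delta' in_keys_iff)
qed

lemma poly_mapping_eq_sum_single:
  "f = (\<Sum>a\<in>Poly_Mapping.keys f. Poly_Mapping.single a (Poly_Mapping.lookup f a))"
  using lookup_sum_single_filter[of f "\<lambda>_. True"] by (intro poly_mapping_eqI) simp

lemma lookup_initial_form:
  "Poly_Mapping.lookup (initial_form w f) a =
     (if \<forall>b\<in>Poly_Mapping.keys f. weight w b \<le> weight w a then Poly_Mapping.lookup f a else 0)"
  unfolding initial_form_def by (rule lookup_sum_single_filter)

lemma lookup_single_mult_add:
  fixes g :: "('k::field_char_0, 'm::finite) mpoly"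
  shows "Poly_Mapping.lookup (Poly_Mapping.single x t * g) (x + b) = t * Poly_Mapping.lookup g b"
  by (simp add: lookup_mult lookup_single when_mult)

lemma lookup_single_mult_not_ge:
  fixes g :: "('k::field_char_0, 'm::finite) mpoly"
  assumes "\<nexists>c. b = x + c"
  shows "Poly_Mapping.lookup (Poly_Mapping.single x t * g) b = 0"
proof (rule ccontr)
  assume "Poly_Mapping.lookup (Poly_Mapping.single x t * g) b \<noteq> 0"
  then have "b \<in> Poly_Mapping.keys (Poly_Mapping.single x t * g)"
    by (simp add: in_keys_iff)
  then show False
    using assms keys_mult[of "Poly_Mapping.single x t" g] by (auto split: if_splits)
qed

text \<open>
  The polynomial \<open>g\<close> has no terms of weight above \<open>c\<close>, and its part of weight exactly \<open>c\<close> is that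
  of \<open>p\<close>. The part may vanish, so that these pairs are closed under addition even when leading
  terms cancel.
\<close>

definition matches_top ::
    "real^'m \<Rightarrow> real \<Rightarrow> ('k::field_char_0, 'm::finite) mpoly \<Rightarrow> ('k, 'm) mpoly \<Rightarrow> bool" where
  "matches_top w c g p \<longleftrightarrow> (\<forall>b. c \<le> weight w b \<longrightarrow>
     Poly_Mapping.lookup g b = (if weight w b = c then Poly_Mapping.lookup p b else 0))"

lemma matches_top_zero: "matches_top w c 0 0"
  by (simp add: matches_top_def)

lemma matches_top_add:
  "matches_top w c g p \<Longrightarrow> matches_top w c h q \<Longrightarrow> matches_top w c (g + h) (p + q)"
  by (simp add: matches_top_def lookup_add)

lemma matches_top_sum:
  "(\<And>i. i \<in> A \<Longrightarrow> matches_top w c (G i) (P i)) \<Longrightarrow> matches_top w c (\<Sum>i\<in>A. G i) (\<Sum>i\<in>A. P i)"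
  by (induction A rule: infinite_finite_induct) (simp_all add: matches_top_zero matches_top_add)

lemma matches_top_single_mult:
  assumes "matches_top w (c - weight w x) g p"
  shows "matches_top w c (Poly_Mapping.single x t * g) (Poly_Mapping.single x t * p)"
  unfolding matches_top_def
proof (intro allI impI)
  fix b assume b: "c \<le> weight w b"
  show "Poly_Mapping.lookup (Poly_Mapping.single x t * g) b =
          (if weight w b = c then Poly_Mapping.lookup (Poly_Mapping.single x t * p) b else 0)"
  proof (cases "\<exists>b'. b = x + b'")
    case True
    then obtain b' where b': "b = x + b'" by blast
    then show ?thesis
      using assms b by (auto simp: matches_top_def lookup_single_mult_add weight_add)
  next
    case False
    then show ?thesis
      by (simp add: lookup_single_mult_not_ge)
  qed
qed

text \<open>
  For products, the components of \<open>p\<close> of different weights have to be matched by different elements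
  of \<open>I\<close>: the part of weight \<open>c\<close> of \<open>q * p\<close> combines each term of \<open>q\<close> with the part of \<open>p\<close> of the
  complementary weight. This is why the property quantifies over all weights \<open>c\<close>.
\<close>

lemma subspace_matches_top:
  fixes I :: "('k::field_char_0, 'm::finite) mpoly set"
  assumes I: "ideal.subspace I"
  shows "ideal.subspace {p. \<forall>c. \<exists>g\<in>I. matches_top w c g p}"
proof (rule ideal.subspaceI; clarify)
  show "\<exists>g\<in>I. matches_top w c g 0" for c
    using ideal.subspace_0[OF I] matches_top_zero by blast
next
  fix p q c
  assume "\<forall>c. \<exists>g\<in>I. matches_top w c g p" "\<forall>c. \<exists>g\<in>I. matches_top w c g q"
  then show "\<exists>g\<in>I. matches_top w c g (p + q)"
    using ideal.subspace_add[OF I] matches_top_add by blast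
next
  fix q p :: "('k, 'm) mpoly" and c
  assume "\<forall>c. \<exists>g\<in>I. matches_top w c g p"
  then obtain g where g: "\<And>c. g c \<in> I" "\<And>c. matches_top w c (g c) p"
    by metis
  let ?term = "\<lambda>a. Poly_Mapping.single a (Poly_Mapping.lookup q a)"
  have "matches_top w c (\<Sum>a\<in>Poly_Mapping.keys q. ?term a * g (c - weight w a))
          (\<Sum>a\<in>Poly_Mapping.keys q. ?term a * p)"
    by (intro matches_top_sum matches_top_single_mult g)
  moreover have "(\<Sum>a\<in>Poly_Mapping.keys q. ?term a * p) = q * p"
    by (simp flip: sum_distrib_right poly_mapping_eq_sum_single)
  moreover have "(\<Sum>a\<in>Poly_Mapping.keys q. ?term a * g (c - weight w a)) \<in> I"
    by (intro ideal.subspace_sum[OF I] ideal.subspace_scale[OF I] g)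
  ultimately show "\<exists>g\<in>I. matches_top w c g (q * p)"
    by metis
qed

text \<open>
  The initial ideal is only generated by initial forms, but each of its weight components is a top
  part of a single element of \<open>I\<close>. In particular a monomial of the initial ideal is the initial form
  of an element of \<open>I\<close>.
\<close>

lemma weight_initial_ideal_matches_top:
  fixes I :: "('k::field_char_0, 'm::finite) mpoly set"
  assumes I: "ideal.subspace I" and p: "p \<in> weight_initial_ideal w I"
  shows "\<exists>g\<in>I. matches_top w c g p"
proof -
  have "\<exists>g\<in>I. matches_top w c g (initial_form w f)" if f: "f \<in> I" for f c
  proof (cases "(\<exists>a\<in>Poly_Mapping.keys f. weight w a = c) \<and>
                (\<forall>a\<in>Poly_Mapping.keys f. weight w a \<le> c)")
    case True
    then have "matches_top w c f (initial_form w f)"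
      by (force simp: matches_top_def lookup_initial_form in_keys_iff)
    with f show ?thesis by blast
  next
    case False
    then have "Poly_Mapping.lookup (initial_form w f) b = 0" if "weight w b = c" for b
      using that by (auto simp: lookup_initial_form in_keys_iff)
    then have "matches_top w c 0 (initial_form w f)"
      by (simp add: matches_top_def)
    with ideal.subspace_0[OF I] show ?thesis by blast
  qed
  then have "weight_initial_ideal w I \<subseteq> {p. \<forall>c. \<exists>g\<in>I. matches_top w c g p}"
    unfolding weight_initial_ideal_def
    by (intro ideal.span_minimal subspace_matches_top[OF I]) blast
  with p show ?thesis by blast
qed

section \<open>The grading of a toric ideal\<close>

definition toric_degree :: "int^'m^'n \<Rightarrow> nat^'m \<Rightarrow> int^'n" where
  "toric_degree V a = (\<Sum>j\<in>UNIV. of_nat (a $ j) * column j V)"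

lemma toric_degree_component:
  "toric_degree V a $ i = (\<Sum>j\<in>UNIV. int (a $ j) * V $ i $ j)"
proof -
  have "(of_nat k :: int^'a) $ i = int k" for k and i :: 'a
    by (induction k) simp_all
  then show ?thesis
    by (simp add: toric_degree_def column_def)
qed

definition toric_component ::
    "int^'m^'n \<Rightarrow> int^'n \<Rightarrow> ('k::field_char_0, 'm::finite) mpoly \<Rightarrow> ('k, 'm) mpoly" where
  "toric_component V d f =
     (\<Sum>a\<in>{a \<in> Poly_Mapping.keys f. toric_degree V a = d}.
        Poly_Mapping.single a (Poly_Mapping.lookup f a))"

lemma lookup_toric_component:
  "Poly_Mapping.lookup (toric_component V d f) a =
     (if toric_degree V a = d then Poly_Mapping.lookup f a else 0)"
  unfolding toric_component_def by (rule lookup_sum_single_filter)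

text \<open>
  The toric map sends the component of degree \<open>d\<close> to the term with exponent \<open>d\<close> of the image, so
  the components of an element of the kernel lie in the kernel.
\<close>

lemma toric_component_mem:
  fixes f :: "('k::field_char_0, 'm::finite) mpoly"
  assumes "f \<in> toric_ideal V"
  shows "toric_component V d f \<in> toric_ideal V"
proof -
  have "toric_map V (toric_component V d f) =
      (\<Sum>a\<in>{a \<in> Poly_Mapping.keys f. toric_degree V a = d}.
         Poly_Mapping.single d (Poly_Mapping.lookup f a))"
    unfolding toric_component_def
    by (simp add: toric_map_sum toric_map_single flip: toric_degree_def cong: conj_cong)
  also have "\<dots> = Poly_Mapping.single d (Poly_Mapping.lookup (toric_map V f) d)"
    by (rule poly_mapping_eqI)
       (auto simp: toric_map_monomials lookup_sum lookup_single when_def sum.inter_filter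
             simp flip: toric_degree_def intro!: sum.cong sum.neutral)
  finally show ?thesis
    using assms by (simp add: toric_ideal_def)
qed

lemma subspace_toric_ideal:
  "ideal.subspace (toric_ideal V :: ('k::field_char_0, 'm::finite) mpoly set)"
  by (rule ideal.subspaceI)
     (simp_all add: toric_ideal_def toric_map_zero toric_map_add toric_map_mult)

lemma weight_shift_row_space:
  fixes V :: "int^'m^'n"
  shows "weight (w + y v* real_matrix V) a =
     weight w a + (\<Sum>i\<in>UNIV. y $ i * real_of_int (toric_degree V a $ i))"
proof -
  let ?t = "\<lambda>i j. y $ i * (real (a $ j) * real_of_int (V $ i $ j))"
  have "(y v* real_matrix V) $ j * real (a $ j) = (\<Sum>i\<in>UNIV. ?t i j)" for j
  proof -
    have "(y v* real_matrix V) $ j = (\<Sum>i\<in>UNIV. y $ i * real_of_int (V $ i $ j))"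
      by (simp add: vector_matrix_mult_def map_matrix_def mult.commute)
    then show ?thesis
      by (simp only: sum_distrib_right mult.assoc mult.commute[of "real (a $ j)"])
  qed
  then have "weight (w + y v* real_matrix V) a = weight w a + (\<Sum>j\<in>UNIV. \<Sum>i\<in>UNIV. ?t i j)"
    by (simp add: weight_def distrib_right sum.distrib)
  also have "(\<Sum>j\<in>UNIV. \<Sum>i\<in>UNIV. ?t i j) = (\<Sum>i\<in>UNIV. \<Sum>j\<in>UNIV. ?t i j)"
    by (rule sum.swap)
  also have "\<dots> = (\<Sum>i\<in>UNIV. y $ i * real_of_int (toric_degree V a $ i))"
    by (simp add: toric_degree_component sum_distrib_left)
  finally show ?thesis .
qed

section \<open>Weights bounded below on the cone of nonnegative relations\<close>

lemma W_cone_nonneg: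
  assumes "w \<in> W_cone V" "u \<in> U_cone V"
  shows "0 \<le> w \<bullet> u"
proof (rule ccontr)
  assume neg: "\<not> 0 \<le> w \<bullet> u"
  obtain L where L: "\<And>u. u \<in> U_cone V \<Longrightarrow> L \<le> w \<bullet> u"
    using assms(1) by (auto simp: W_cone_def bdd_below_def)
  define t where "t = (\<bar>L\<bar> + 1) / \<bar>w \<bullet> u\<bar>"
  have "t *\<^sub>R u \<in> U_cone V"
    using assms(2) by (auto simp: U_cone_def t_def matrix_vector_mult_scaleR)
  then have "L \<le> t * (w \<bullet> u)"
    using L by fastforce
  moreover have "t * (w \<bullet> u) = - (\<bar>L\<bar> + 1)"
    using neg by (simp add: t_def field_simps)
  ultimately show False by linarith
qed

text \<open>
  The vectors \<open>w\<close> for which some shift by the row space of \<open>A\<close> is nonnegative contain the cone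
  generated by the rows, their negatives and the unit vectors. This finitely generated cone is
  closed, so if it missed \<open>w\<close>, a separating hyperplane would have a normal vector \<open>u\<close> that is
  nonnegative, orthogonal to the rows and of negative product with \<open>w\<close>.
\<close>

lemma farkas:
  fixes A :: "real^'m^'n"
  assumes "\<And>u. A *v u = 0 \<Longrightarrow> (\<And>j. 0 \<le> u $ j) \<Longrightarrow> 0 \<le> w \<bullet> u"
  obtains y where "\<And>j. 0 \<le> (w + y v* A) $ j"
proof -
  define S where
    "S = range (\<lambda>i. axis i 1 v* A) \<union> range (\<lambda>i. - (axis i 1 v* A)) \<union> range (\<lambda>j. axis j (1::real))"
  let ?C = "convex_cone hull S"
  have S: "finite S"
    by (simp add: S_def)
  have "w \<in> ?C"
  proof (rule ccontr)
    assume "w \<notin> ?C"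
    then obtain u b where u: "u \<bullet> w < b" "\<And>x. x \<in> ?C \<Longrightarrow> b < u \<bullet> x"
      using separating_hyperplane_closed_point[of ?C w] closed_convex_cone_hull[OF S]
        convex_convex_cone_hull by blast
    have "b < 0"
      using u(2)[OF convex_cone_hull_contains_0] by simp
    have dual: "0 \<le> u \<bullet> x" if "x \<in> S" for x
    proof (rule ccontr)
      \<comment> \<open>a positive multiple of \<open>x\<close> would reach the hyperplane \<open>u \<bullet> z = b\<close>\<close>
      assume "\<not> 0 \<le> u \<bullet> x"
      moreover have "(b / (u \<bullet> x)) *\<^sub>R x \<in> ?C"
        using calculation \<open>b < 0\<close> that
        by (intro convex_cone_hull_mul hull_inc) (simp_all add: divide_nonpos_neg)
      ultimately show False
        using u(2)[of "(b / (u \<bullet> x)) *\<^sub>R x"] by simp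
    qed
    have "0 \<le> u $ j" for j
      using dual[of "axis j 1"] by (simp add: S_def inner_axis)
    moreover have "A *v u = 0"
    proof -
      have "(A *v u) $ i = 0" for i
      proof -
        have "(A *v u) $ i = u \<bullet> (axis i 1 v* A)"
          by (simp add: inner_commute[of u] dot_lmul_matrix inner_commute[of "axis i 1"] inner_axis)
        moreover have "0 \<le> u \<bullet> (axis i 1 v* A)" "0 \<le> u \<bullet> (- (axis i 1 v* A))"
          by (rule dual; simp add: S_def)+
        ultimately show ?thesis by simp
      qed
      then show ?thesis by (simp add: vec_eq_iff)
    qed
    ultimately have "0 \<le> w \<bullet> u"
      using assms by blast
    then show False
      using u(1) \<open>b < 0\<close> by (simp add: inner_commute)
  qed
  let ?D = "{x. \<exists>y. \<forall>j. 0 \<le> (x + y v* A) $ j}"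
  have "S \<subseteq> ?D"
  proof -
    have "axis i 1 v* A \<in> ?D" for i
      by (intro CollectI exI[of _ "- axis i 1"]) (simp add: vector_matrix_mult_def sum_negf)
    moreover have "- (axis i 1 v* A) \<in> ?D" for i
      by (intro CollectI exI[of _ "axis i 1"]) simp
    moreover have "axis j 1 \<in> ?D" for j
      by (intro CollectI exI[of _ 0]) (simp add: axis_def)
    ultimately show ?thesis
      by (auto simp: S_def)
  qed
  moreover have "convex_cone ?D"
    unfolding convex_cone_iff
  proof (intro conjI ballI allI impI)
    show "0 \<in> ?D"
      by (intro CollectI exI[of _ 0]) simp
    show "x + x' \<in> ?D" if "x \<in> ?D" "x' \<in> ?D" for x x'
    proof -
      obtain y y' where "\<And>j. 0 \<le> (x + y v* A) $ j" "\<And>j. 0 \<le> (x' + y' v* A) $ j"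
        using \<open>x \<in> ?D\<close> \<open>x' \<in> ?D\<close> by blast
      then have "0 \<le> (x + y v* A) $ j + (x' + y' v* A) $ j" for j
        by (simp add: add_nonneg_nonneg)
      then show ?thesis
        by (intro CollectI exI[of _ "y + y'"]) (simp add: vector_matrix_left_distrib algebra_simps)
    qed
    show "c *\<^sub>R x \<in> ?D" if "x \<in> ?D" "0 \<le> c" for x c
    proof -
      obtain y where "\<And>j. 0 \<le> (x + y v* A) $ j"
        using \<open>x \<in> ?D\<close> by blast
      then have "0 \<le> c * (x + y v* A) $ j" for j
        using \<open>0 \<le> c\<close> by simp
      then show ?thesis
        by (intro CollectI exI[of _ "c *\<^sub>R y"]) (simp add: scaleR_vector_matrix_assoc distrib_left)
    qed
  qed
  ultimately have "?C \<subseteq> ?D"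
    by (rule hull_minimal)
  with \<open>w \<in> ?C\<close> that show thesis by blast
qed

text \<open>
  Let \<open>p\<close> be an integer vector very close to \<open>q u\<close>, where \<open>q\<close> is a positive integer. Each entry of
  \<open>V p\<close> is an integer close to an entry of \<open>q V u = 0\<close>, hence zero; each \<open>p\<^sub>j\<close> is an integer close to
  a nonnegative number, hence nonnegative; and \<open>w \<bullet> p\<close> is close to \<open>q (w \<bullet> u) \<le> w \<bullet> u < 0\<close>.
\<close>

lemma nat_relation_of_negative_weight:
  fixes V :: "int^'m^'n"
  assumes u: "u \<in> U_cone V" and neg: "w \<bullet> u < 0"
  obtains a :: "nat^'m" where "toric_degree V a = 0" "weight w a < 0"
proof -
  obtain h where h: "bij_betw h {0..<CARD('m)} (UNIV :: 'm set)"
    using ex_bij_betw_nat_finite[of "UNIV :: 'm set"] by auto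
  \<comment> \<open>an approximation error below \<open>1 / B\<close> per coordinate moves the weight by less than
    \<open>\<bar>w \<bullet> u\<bar>\<close> and each entry of \<open>V p\<close> by less than \<open>1\<close>\<close>
  define B where
    "B = (\<Sum>j\<in>UNIV. \<bar>w $ j\<bar>) / \<bar>w \<bullet> u\<bar> + (\<Sum>i\<in>UNIV. \<Sum>j\<in>UNIV. \<bar>real_of_int (V $ i $ j)\<bar>) + 1"
  have B: "(\<Sum>j\<in>UNIV. \<bar>w $ j\<bar>) / \<bar>w \<bullet> u\<bar> < B"
    "(\<Sum>i\<in>UNIV. \<Sum>j\<in>UNIV. \<bar>real_of_int (V $ i $ j)\<bar>) < B" "1 \<le> B"
    unfolding B_def by (simp_all add: add_pos_nonneg add_nonneg_pos sum_nonneg)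
  obtain N :: nat where N: "B \<le> real N"
    using real_arch_simple by blast
  then have "0 < N"
    using B by (cases N) auto
  then obtain q p' where q: "0 < q"
    and p': "\<And>k. k < CARD('m) \<Longrightarrow> \<bar>of_int q * (u $ h k) - of_int (p' k)\<bar> < 1 / N"
    using Dirichlet_approx_simult[of N "CARD('m)" "\<lambda>k. u $ h k"] by metis
  define p where "p j = p' (inv_into {0..<CARD('m)} h j)" for j
  have p: "\<bar>of_int q * (u $ j) - of_int (p j)\<bar> < 1 / N" for j
    using p'[of "inv_into {0..<CARD('m)} h j"] h
    by (metis UNIV_I atLeastLessThan_iff bij_betw_imp_surj_on f_inv_into_f inv_into_into p_def)
  have u': "real_matrix V *v u = 0" "\<And>j. 0 \<le> u $ j"
    using u by (auto simp: U_cone_def)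
  have p_nonneg: "0 \<le> p j" for j
  proof -
    have "0 \<le> of_int q * (u $ j)" "1 / real N \<le> 1"
      using q u'(2) \<open>0 < N\<close> by simp_all
    then have "real_of_int (p j) > -1"
      using p[of j] by linarith
    then show ?thesis by linarith
  qed
  have err: "\<bar>(\<Sum>j\<in>UNIV. c j * of_int (p j)) - of_int q * (\<Sum>j\<in>UNIV. c j * u $ j)\<bar>
      \<le> (\<Sum>j\<in>UNIV. \<bar>c j\<bar>) / N" for c :: "'m \<Rightarrow> real"
  proof -
    have "(\<Sum>j\<in>UNIV. c j * of_int (p j)) - of_int q * (\<Sum>j\<in>UNIV. c j * u $ j) =
        (\<Sum>j\<in>UNIV. c j * (of_int (p j) - of_int q * u $ j))"
      unfolding sum_distrib_left sum_subtractf[symmetric]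
      by (rule sum.cong) (simp_all add: right_diff_distrib)
    also have "\<bar>\<dots>\<bar> \<le> (\<Sum>j\<in>UNIV. \<bar>c j * (of_int (p j) - of_int q * u $ j)\<bar>)"
      by (rule sum_abs)
    also have "\<dots> \<le> (\<Sum>j\<in>UNIV. \<bar>c j\<bar> * (1 / N))"
    proof (rule sum_mono)
      fix j
      have "\<bar>of_int (p j) - of_int q * u $ j\<bar> \<le> 1 / N"
        using p[of j] by linarith
      then show "\<bar>c j * (of_int (p j) - of_int q * u $ j)\<bar> \<le> \<bar>c j\<bar> * (1 / N)"
        unfolding abs_mult by (intro mult_left_mono) simp_all
    qed
    finally show ?thesis
      by (simp add: sum_divide_distrib)
  qed
  define a :: "nat^'m" where "a = (\<chi> j. nat (p j))"
  have a: "int (a $ j) = p j" for j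
    using p_nonneg by (simp add: a_def)
  have a_real: "real (a $ j) = real_of_int (p j)" for j
    using a[of j] by (metis of_int_of_nat_eq)
  show ?thesis
  proof (rule that)
    show "toric_degree V a = 0"
    proof -
      have "toric_degree V a $ i = 0" for i
      proof -
        have "(\<Sum>j\<in>UNIV. real_of_int (V $ i $ j) * u $ j) = 0"
          using arg_cong[OF u'(1), of "\<lambda>x. x $ i"]
          by (simp add: matrix_vector_mult_def map_matrix_def)
        then have "\<bar>real_of_int (toric_degree V a $ i)\<bar> \<le> (\<Sum>j\<in>UNIV. \<bar>real_of_int (V $ i $ j)\<bar>) / N"
          using err[of "\<lambda>j. real_of_int (V $ i $ j)"]
          by (simp add: toric_degree_component a mult.commute)
        also have "(\<Sum>j\<in>UNIV. \<bar>real_of_int (V $ i $ j)\<bar>) \<le> (\<Sum>i\<in>UNIV. \<Sum>j\<in>UNIV. \<bar>real_of_int (V $ i $ j)\<bar>)"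
          by (rule member_le_sum[of i UNIV "\<lambda>i. \<Sum>j\<in>UNIV. \<bar>real_of_int (V $ i $ j)\<bar>"])
             (auto intro: sum_nonneg)
        also have "\<dots> / N < 1"
          using B(2) N \<open>0 < N\<close> by simp
        finally show ?thesis
          using \<open>0 < N\<close> by (simp add: divide_right_mono)
      qed
      then show ?thesis by (simp add: vec_eq_iff)
    qed
    have "weight w a \<le> of_int q * (w \<bullet> u) + (\<Sum>j\<in>UNIV. \<bar>w $ j\<bar>) / N"
      using err[of "\<lambda>j. w $ j"] by (simp add: weight_def a_real inner_vec_def)
    also have "of_int q * (w \<bullet> u) \<le> w \<bullet> u"
      using q neg by (simp add: mult_le_cancel_right2)
    also have "w \<bullet> u + (\<Sum>j\<in>UNIV. \<bar>w $ j\<bar>) / N < 0"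
    proof -
      have "(\<Sum>j\<in>UNIV. \<bar>w $ j\<bar>) < \<bar>w \<bullet> u\<bar> * B"
        using B(1) pos_divide_less_eq[of "\<bar>w \<bullet> u\<bar>" _ B] neg
        by (metis mult.commute order_less_irrefl zero_less_abs_iff)
      also have "\<dots> \<le> \<bar>w \<bullet> u\<bar> * N"
        using N by (simp add: mult_left_mono)
      finally have "(\<Sum>j\<in>UNIV. \<bar>w $ j\<bar>) / N < \<bar>w \<bullet> u\<bar>"
        using \<open>0 < N\<close> by (simp add: pos_divide_less_eq)
      then show ?thesis using neg by linarith
    qed
    finally show "weight w a < 0" by simp
  qed
qed

section \<open>Initial ideals of a toric ideal\<close>

text \<open>
  As \<open>0\<close> is the least exponent, an element of the toric ideal with leading exponent \<open>0\<close> is a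
  constant, and the toric map is injective on constants.
\<close>

lemma order_initial_ideal_proper:
  fixes V :: "int^'m^'n"
  assumes R: "term_order R"
  shows "1 \<notin> order_initial_ideal R (toric_ideal V :: ('k::field_char_0, 'm) mpoly set)"
proof
  let ?I = "toric_ideal V :: ('k, 'm) mpoly set"
  assume "1 \<in> order_initial_ideal R ?I"
  then have "1 \<in> ideal.span ((\<lambda>a. Poly_Mapping.single a (1::'k)) ` {a. \<exists>f\<in>?I. is_leading_exponent R f a})"
    by (simp add: order_initial_ideal_def setcompr_eq_image)
  moreover have "0 \<in> Poly_Mapping.keys (1 :: ('k, 'm) mpoly)"
    by (simp add: in_keys_iff flip: single_one)
  ultimately obtain f a c where f: "f \<in> ?I" "is_leading_exponent R f a" and "0 = c + a"
    using keys_in_monomial_span by blast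
  then have a: "a = 0"
    by (simp add: vec_eq_iff)
  have "b = 0" if "b \<in> Poly_Mapping.keys f" for b
    using that f(2) R unfolding is_leading_exponent_def a term_order_def order_on_defs
    by (meson antisymD)
  then have "f = Poly_Mapping.single 0 (Poly_Mapping.lookup f 0)"
    by (intro poly_mapping_eqI) (auto simp: lookup_single when_def in_keys_iff)
  then have "toric_map V f = Poly_Mapping.single 0 (Poly_Mapping.lookup f 0)"
    by (metis toric_map_constant)
  then have "Poly_Mapping.single 0 (Poly_Mapping.lookup f 0) = (0 :: ('k, 'n) laurent)"
    using f(1) by (simp add: toric_ideal_def)
  then have "Poly_Mapping.lookup f 0 = 0"
    using lookup_single_eq[of "0 :: int^'n" "Poly_Mapping.lookup f 0"] by simp
  then show False
    using f(2) a by (simp add: is_leading_exponent_def in_keys_iff)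
qed

text \<open>
  Otherwise a relation of negative weight gives a binomial in the toric ideal with initial form \<open>1\<close>.
\<close>

lemma initial_ideal_imp_W_cone:
  fixes V :: "int^'m^'n"
  assumes R: "term_order R"
    and eq: "weight_initial_ideal w (toric_ideal V :: ('k::field_char_0, 'm) mpoly set) =
             order_initial_ideal R (toric_ideal V)"
  shows "w \<in> W_cone V"
proof (rule ccontr)
  assume "w \<notin> W_cone V"
  then obtain u where "u \<in> U_cone V" "w \<bullet> u < 0"
    unfolding W_cone_def bdd_below_def by (auto simp: not_le)
  then obtain a :: "nat^'m" where a: "toric_degree V a = 0" "weight w a < 0"
    by (rule nat_relation_of_negative_weight)
  have weight0: "weight w 0 = 0"
    by (simp add: weight_def)
  then have "a \<noteq> 0"
    using a(2) by auto
  define f :: "('k, 'm) mpoly" where "f = Poly_Mapping.single a (-1) + Poly_Mapping.single 0 1"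
  have "f \<in> toric_ideal V"
  proof -
    have "toric_map V f = Poly_Mapping.single (toric_degree V a) (-1) + Poly_Mapping.single 0 1"
      by (simp add: f_def toric_map_add toric_map_constant toric_map_single[of V a] toric_degree_def
          del: single_one)
    also have "\<dots> = 0"
      by (simp only: a(1) flip: single_add) simp
    finally show ?thesis
      by (simp add: toric_ideal_def)
  qed
  moreover have "initial_form w f = 1"
  proof (rule poly_mapping_eqI)
    fix b
    have lookup_f: "Poly_Mapping.lookup f b = (if b = a then -1 else if b = 0 then 1 else 0)" for b
      using \<open>a \<noteq> 0\<close> by (auto simp: f_def lookup_add lookup_single lookup_one when_def)
    have keys: "Poly_Mapping.keys f = {a, 0}"
      by (auto simp: in_keys_iff lookup_f split: if_splits)
    show "Poly_Mapping.lookup (initial_form w f) b = Poly_Mapping.lookup 1 b"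
      using a(2) weight0 \<open>a \<noteq> 0\<close>
      by (simp add: lookup_initial_form lookup_f keys lookup_one when_def)
  qed
  ultimately have "1 \<in> weight_initial_ideal w (toric_ideal V :: ('k, 'm) mpoly set)"
    unfolding weight_initial_ideal_def by (metis ideal.span_base imageI)
  then show False
    using order_initial_ideal_proper[OF R] eq by blast
qed

text \<open>
  The order has to refine the weight only within each degree, because passing to a homogeneous
  component of an element of the toric ideal keeps it in the ideal and keeps its leading term.
\<close>

lemma weight_initial_ideal_eq_order_initial_ideal:
  fixes V :: "int^'m^'n"
  assumes generic: "generic_weight w (toric_ideal V :: ('k::field_char_0, 'm) mpoly set)"
    and R: "term_order R"
    and refines: "\<And>a b. toric_degree V a = toric_degree V b \<Longrightarrow> weight w a < weight w b \<Longrightarrow> (a, b) \<in> R"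
  shows "weight_initial_ideal w (toric_ideal V :: ('k, 'm) mpoly set) =
         order_initial_ideal R (toric_ideal V)"
proof
  let ?I = "toric_ideal V :: ('k, 'm) mpoly set"
  let ?J = "weight_initial_ideal w ?I"
  have J: "monomial_ideal ?J"
    using generic by (simp add: generic_weight_def)
  have antisym: "a = b" if "(a, b) \<in> R" "(b, a) \<in> R" for a b
    using that R by (auto simp: term_order_def order_on_defs antisym_def)
  have refl: "(a, a) \<in> R" for a
    using R by (auto simp: term_order_def order_on_defs refl_on_def)
  show "order_initial_ideal R ?I \<subseteq> ?J"
    unfolding order_initial_ideal_def
  proof (rule ideal.span_minimal)
    show "ideal.subspace ?J"
      by (simp add: weight_initial_ideal_def)
    show "{Poly_Mapping.single a 1 |a. \<exists>f\<in>?I. is_leading_exponent R f a} \<subseteq> ?J"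
    proof clarify
      fix a f assume f: "f \<in> ?I" and lead: "is_leading_exponent R f a"
      define g where "g = toric_component V (toric_degree V a) f"
      have "weight w b \<le> weight w a" if "b \<in> Poly_Mapping.keys g" for b
      proof (rule ccontr)
        assume "\<not> weight w b \<le> weight w a"
        moreover have "toric_degree V b = toric_degree V a" "b \<in> Poly_Mapping.keys f"
          using that by (auto simp: g_def in_keys_iff lookup_toric_component split: if_splits)
        ultimately have "(a, b) \<in> R" "(b, a) \<in> R"
          using refines lead by (auto simp: is_leading_exponent_def)
        with antisym \<open>\<not> weight w b \<le> weight w a\<close> show False by blast
      qed
      then have "a \<in> Poly_Mapping.keys (initial_form w g)"
        using lead by (auto simp: in_keys_iff lookup_initial_form g_def lookup_toric_component
            is_leading_exponent_def)
      moreover have "initial_form w g \<in> ?J"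
        using toric_component_mem[OF f] unfolding g_def weight_initial_ideal_def
        by (intro ideal.span_base imageI)
      ultimately show "Poly_Mapping.single a 1 \<in> ?J"
        using monomial_ideal_monomials[OF J] by blast
    qed
  qed
  obtain A where A: "?J = ideal.span ((\<lambda>a. Poly_Mapping.single a 1) ` A)"
    using J by (auto simp: monomial_ideal_def)
  have "Poly_Mapping.single a 1 \<in> order_initial_ideal R ?I" if "a \<in> A" for a
  proof -
    have "Poly_Mapping.single a 1 \<in> ?J"
      unfolding A using that by (intro ideal.span_base) auto
    then obtain g where g: "g \<in> ?I" "matches_top w (weight w a) g (Poly_Mapping.single a 1)"
      using weight_initial_ideal_matches_top[OF subspace_toric_ideal] by blast
    define h where "h = toric_component V (toric_degree V a) g"
    have "is_leading_exponent R h a"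
      unfolding is_leading_exponent_def
    proof
      show "a \<in> Poly_Mapping.keys h"
        using g(2) by (simp add: matches_top_def h_def in_keys_iff lookup_toric_component)
      show "\<forall>b\<in>Poly_Mapping.keys h. (b, a) \<in> R"
      proof
        fix b assume "b \<in> Poly_Mapping.keys h"
        then have b: "toric_degree V b = toric_degree V a" "Poly_Mapping.lookup g b \<noteq> 0"
          by (auto simp: h_def in_keys_iff lookup_toric_component split: if_splits)
        show "(b, a) \<in> R"
        proof (cases "b = a")
          case False
          then have "weight w b < weight w a"
            using g(2) b(2) unfolding matches_top_def
            by (metis leI lookup_single_not_eq)
          then show ?thesis
            using refines b(1) by blast
        qed (simp add: refl)
      qed
    qed
    moreover have "h \<in> ?I"
      unfolding h_def by (rule toric_component_mem[OF g(1)])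
    ultimately show ?thesis
      unfolding order_initial_ideal_def by (intro ideal.span_base) blast
  qed
  then show "?J \<subseteq> order_initial_ideal R ?I"
    unfolding A
    by (intro ideal.span_minimal) (auto simp: order_initial_ideal_def)
qed

theorem theorem2:
  fixes V :: "int^'m^'n" and w :: "real^'m"
  assumes "F_matrix V"
    and "generic_weight w (toric_ideal V :: ('k::field_char_0, 'm) mpoly set)"
  shows "is_initial_ideal
           (weight_initial_ideal w (toric_ideal V :: ('k, 'm) mpoly set)) (toric_ideal V)
         \<longleftrightarrow> w \<in> W_cone V"
proof
  assume "is_initial_ideal (weight_initial_ideal w (toric_ideal V :: ('k, 'm) mpoly set)) (toric_ideal V)"
  then show "w \<in> W_cone V"
    unfolding is_initial_ideal_def using initial_ideal_imp_W_cone by blast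
next
  assume w: "w \<in> W_cone V"
  obtain y where y: "\<And>j. 0 \<le> (w + y v* real_matrix V) $ j"
    using farkas[of "real_matrix V" w] W_cone_nonneg[OF w] by (auto simp: U_cone_def)
  obtain R where R: "term_order R"
    and weight_R: "\<And>a b. weight (w + y v* real_matrix V) a < weight (w + y v* real_matrix V) b
                     \<Longrightarrow> (a, b) \<in> R"
    using term_order_refining_weight[OF y] by blast
  have "(a, b) \<in> R" if "toric_degree V a = toric_degree V b" "weight w a < weight w b" for a b
    using that by (intro weight_R) (simp add: weight_shift_row_space)
  then have "weight_initial_ideal w (toric_ideal V :: ('k, 'm) mpoly set) =
             order_initial_ideal R (toric_ideal V)"
    by (intro weight_initial_ideal_eq_order_initial_ideal assms R)
  with R assms(2) show
    "is_initial_ideal (weight_initial_ideal w (toric_ideal V :: ('k, 'm) mpoly set)) (toric_ideal V)"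
    unfolding is_initial_ideal_def generic_weight_def by blast
qed

end
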